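(* Let $(X,d)$ be a nonempty pseudometric space and let $Q=\{X_j : j\in J\}$ be the partition of $X$ into the equivalence classes of $\sim_d$ (blocks with different indices being different). Then $(X,d)\in\mathcal{IP}$ if and only if $$P_{d^{-1}}\in\{Q\otimes_1 Q,\; Q\otimes_2 Q,\; Q\otimes_3 Q\}$$ (where $Q\otimes_3 Q$ is present in this set only when $Q$ has exactly four blocks) and $|X_{j_1}|\ne|X_{j_2}|$ holds whenever $j_1,j_2\in J$ are distinct.
   Context: A pseudometric on a set $X$ is a function $d\colon X^2\to\mathbb{R}$ that is non-negative, symmetric, satisfies $d(x,x)=0$ for all $x$, and satisfies the triangle inequality. Write $d(X^2)=\{d(x,y):x,y\in X\}$. The relation $x\sim_d y :\Leftrightarrow d(x,y)=0$ is an equivalence relation on $X$; the metric reflection of $(X,d)$ is the metric space $(X/{\sim_d},\delta_d)$ with $\delta_d(\alpha,\beta)=d(x,y)$ for $x\in\alpha$, $y\in\beta$. A combinatorial self-similarity of $(X,d)$ is a bijection $\Psi\colon X\to X$ for which there is a bijection $f\colon d(X^2)\to d(X^2)$ with $d(x,y)=f(d(\Psi(x),\Psi(y)))$ for all $x,y\in X$; $\mathbf{Cs}(X,d)$ is the group of all of them. $\mathbf{PI}(X,d)$ is the group of all bijections $f\colon X\to X$ with $d(x,f(x))=0$ for all $x\in X$. $\mathbf{Sym}(X)$ is the group of all permutations of $X$. The class $\mathcal{IP}$ consists of all pseudometric spaces $(X,d)$ with $\mathbf{Cs}(X,d)=\mathbf{PI}(X,d)$ and $\mathbf{Cs}(X/{\sim_d},\delta_d)=\mathbf{Sym}(X/{\sim_d})$.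 $P_{d^{-1}}:=\{d^{-1}(t): t\in d(X^2)\}$, where $d^{-1}(t)=\{\langle x,y\rangle\in X^2: d(x,y)=t\}$; it is a partition of $X^2$. For a partition $Q=\{X_j:j\in J\}$ of $X$ the following partitions of $X^2$ are defined. If $|J|=1$, then $Q\otimes_1 Q=Q\otimes_2 Q=\{X^2\}$. If $|J|\geq 2$: the blocks of $Q\otimes_1 Q$ are $\bigcup_{j\in J}X_j^2$ and all sets $(X_{j_1}\times X_{j_2})\cup(X_{j_2}\times X_{j_1})$ with distinct $j_1,j_2\in J$; the blocks of $Q\otimes_2 Q$ are $\bigcup_{j\in J}X_j^2$ and $X^2\setminus\bigcup_{j\in J}X_j^2$. If $Q=\{X_1,X_2,X_3,X_4\}$ has exactly four blocks, $Q\otimes_3 Q$ is the partition of $X^2$ with the four blocks $\bigcup_{i=1}^4X_i^2$, $(X_1\times X_2)\cup(X_2\times X_1)\cup(X_3\times X_4)\cup(X_4\times X_3)$, $(X_1\times X_3)\cup(X_3\times X_1)\cup(X_2\times X_4)\cup(X_4\times X_2)$, $(X_1\times X_4)\cup(X_4\times X_1)\cup(X_2\times X_3)\cup(X_3\times X_2)$ (this does not depend on the numbering of the blocks). *)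

theory Defs
  imports Complex_Main "HOL-Combinatorics.Permutations" "HOL-Library.Equipollence"
begin

definition pseudometric_on :: "'a set \<Rightarrow> ('a \<Rightarrow> 'a \<Rightarrow> real) \<Rightarrow> bool" where
  "pseudometric_on X d \<longleftrightarrow>
     (\<forall>x\<in>X. \<forall>y\<in>X. 0 \<le> d x y) \<and>
     (\<forall>x\<in>X. \<forall>y\<in>X. d x y = d y x) \<and>
     (\<forall>x\<in>X. d x x = 0) \<and>
     (\<forall>x\<in>X. \<forall>y\<in>X. \<forall>z\<in>X. d x z \<le> d x y + d y z)"

definition dist_set :: "'a set \<Rightarrow> ('a \<Rightarrow> 'a \<Rightarrow> real) \<Rightarrow> real set" where
  "dist_set X d = {d x y |x y. x \<in> X \<and> y \<in> X}"

definition zero_rel :: "'a set \<Rightarrow> ('a \<Rightarrow> 'a \<Rightarrow> real) \<Rightarrow> ('a \<times> 'a) set" where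
  "zero_rel X d = {(x, y) \<in> X \<times> X. d x y = 0}"

definition refl_dist :: "('a \<Rightarrow> 'a \<Rightarrow> real) \<Rightarrow> 'a set \<Rightarrow> 'a set \<Rightarrow> real" where
  "refl_dist d A B = (THE t. \<exists>x\<in>A. \<exists>y\<in>B. t = d x y)"

text \<open>
  A self-bijection of a carrier \<open>X\<close> is represented by the unique function that agrees
  with it on \<open>X\<close> and is the identity outside \<open>X\<close>.  Since all groups below are groups of
  permutations of the same carrier under composition, they are equal if and only if their
  underlying sets are.
\<close>

definition Sym :: "'a set \<Rightarrow> ('a \<Rightarrow> 'a) set" where
  "Sym X = {p. p permutes X}"

definition Cs :: "'a set \<Rightarrow> ('a \<Rightarrow> 'a \<Rightarrow> real) \<Rightarrow> ('a \<Rightarrow> 'a) set" where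
  "Cs X d = {\<Psi> \<in> Sym X. \<exists>f. bij_betw f (dist_set X d) (dist_set X d) \<and>
                            (\<forall>x\<in>X. \<forall>y\<in>X. d x y = f (d (\<Psi> x) (\<Psi> y)))}"

definition PI :: "'a set \<Rightarrow> ('a \<Rightarrow> 'a \<Rightarrow> real) \<Rightarrow> ('a \<Rightarrow> 'a) set" where
  "PI X d = {p \<in> Sym X. \<forall>x\<in>X. d x (p x) = 0}"

definition in_IP :: "'a set \<Rightarrow> ('a \<Rightarrow> 'a \<Rightarrow> real) \<Rightarrow> bool" where
  "in_IP X d \<longleftrightarrow> pseudometric_on X d \<and> Cs X d = PI X d \<and>
     Cs (X // zero_rel X d) (refl_dist d) = Sym (X // zero_rel X d)"

definition dist_partition :: "'a set \<Rightarrow> ('a \<Rightarrow> 'a \<Rightarrow> real) \<Rightarrow> ('a \<times> 'a) set set" where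
  "dist_partition X d = (\<lambda>t. {(x, y) \<in> X \<times> X. d x y = t}) ` dist_set X d"

text \<open>
  The partitions \<open>Q \<otimes>\<^sub>i Q\<close> of \<open>X\<^sup>2\<close> for a partition \<open>Q\<close> of the nonempty set \<open>X = \<Union>Q\<close>.
  Infinite \<open>Q\<close> have \<open>card Q = 0\<close> and so are covered by the second case.
\<close>

definition diag_block :: "'a set set \<Rightarrow> ('a \<times> 'a) set" where
  "diag_block Q = (\<Union>A\<in>Q. A \<times> A)"

definition sym_prod :: "'a set \<Rightarrow> 'a set \<Rightarrow> ('a \<times> 'a) set" where
  "sym_prod A B = A \<times> B \<union> B \<times> A"

definition tensor1 :: "'a set set \<Rightarrow> ('a \<times> 'a) set set" where
  "tensor1 Q = (if card Q = 1 then {\<Union>Q \<times> \<Union>Q}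
     else insert (diag_block Q) {sym_prod A B |A B. A \<in> Q \<and> B \<in> Q \<and> A \<noteq> B})"

definition tensor2 :: "'a set set \<Rightarrow> ('a \<times> 'a) set set" where
  "tensor2 Q = (if card Q = 1 then {\<Union>Q \<times> \<Union>Q}
     else {diag_block Q, \<Union>Q \<times> \<Union>Q - diag_block Q})"

text \<open>Only meaningful when \<open>Q\<close> has exactly four elements; see \<open>tensor3_eq\<close>.\<close>

definition tensor3 :: "'a set set \<Rightarrow> ('a \<times> 'a) set set" where
  "tensor3 Q = (THE P. \<exists>A B C D. distinct [A, B, C, D] \<and> Q = {A, B, C, D} \<and>
     P = {diag_block Q,
          sym_prod A B \<union> sym_prod C D,
          sym_prod A C \<union> sym_prod B D,
          sym_prod A D \<union> sym_prod B C})"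

lemma sym_prod_commute: "sym_prod A B = sym_prod B A"
  by (auto simp: sym_prod_def)

lemma tensor3_eq:
  assumes "distinct [A, B, C, D]"
  shows "tensor3 {A, B, C, D} =
    {diag_block {A, B, C, D},
     sym_prod A B \<union> sym_prod C D,
     sym_prod A C \<union> sym_prod B D,
     sym_prod A D \<union> sym_prod B C}"
proof -
  let ?R = "\<lambda>A B C D. {sym_prod A B \<union> sym_prod C D,
     sym_prod A C \<union> sym_prod B D, sym_prod A D \<union> sym_prod B C}"
  have *: "?R A' B' C' D' = ?R A B C D"
    if dis: "distinct [A', B', C', D']" and eq: "{A, B, C, D} = {A', B', C', D'}" for A' B' C' D'
  proof -
    have "A' = A \<or> A' = B \<or> A' = C \<or> A' = D" "B' = A \<or> B' = B \<or> B' = C \<or> B' = D"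
      "C' = A \<or> C' = B \<or> C' = C \<or> C' = D" "D' = A \<or> D' = B \<or> D' = C \<or> D' = D"
      using eq by blast+
    moreover have "A' \<noteq> B'" "A' \<noteq> C'" "A' \<noteq> D'" "B' \<noteq> C'" "B' \<noteq> D'" "C' \<noteq> D'"
      using dis by auto
    ultimately show ?thesis
      apply (elim disjE)
      apply (simp_all only: simp_thms)
      apply (simp_all only: sym_prod_commute insert_commute Un_commute)
      done
  qed
  show ?thesis
    unfolding tensor3_def
  proof (rule the_equality)
    show "\<exists>A' B' C' D'. distinct [A', B', C', D'] \<and> {A, B, C, D} = {A', B', C', D'} \<and>
      {diag_block {A, B, C, D}, sym_prod A B \<union> sym_prod C D,
       sym_prod A C \<union> sym_prod B D, sym_prod A D \<union> sym_prod B C} =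
      insert (diag_block {A, B, C, D}) (?R A' B' C' D')"
      by (intro exI[of _ A] exI[of _ B] exI[of _ C] exI[of _ D] conjI assms refl)
  next
    fix P assume "\<exists>A' B' C' D'. distinct [A', B', C', D'] \<and> {A, B, C, D} = {A', B', C', D'} \<and>
      P = insert (diag_block {A, B, C, D}) (?R A' B' C' D')"
    then obtain A' B' C' D' where h: "distinct [A', B', C', D']" "{A, B, C, D} = {A', B', C', D'}"
      "P = insert (diag_block {A, B, C, D}) (?R A' B' C' D')"
      by (elim exE conjE)
    show "P = insert (diag_block {A, B, C, D}) (?R A B C D)"
      unfolding h(3) *[OF h(1,2)] ..
  qed
qed

lemma equiv_zero_rel:
  assumes "pseudometric_on X d"
  shows "equiv X (zero_rel X d)"
proof (rule equivI)
  show "zero_rel X d \<subseteq> X \<times> X"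
    by (auto simp: zero_rel_def)
  show "refl_on X (zero_rel X d)"
    using assms by (auto simp: refl_on_def zero_rel_def pseudometric_on_def)
  show "sym (zero_rel X d)"
    using assms by (auto simp: sym_def zero_rel_def pseudometric_on_def)
  show "trans (zero_rel X d)"
  proof (rule transI)
    fix x y z assume "(x, y) \<in> zero_rel X d" "(y, z) \<in> zero_rel X d"
    then have *: "x \<in> X" "y \<in> X" "z \<in> X" "d x y = 0" "d y z = 0"
      by (auto simp: zero_rel_def)
    then have "d x z \<le> d x y + d y z" "0 \<le> d x z"
      using assms unfolding pseudometric_on_def by blast+
    then show "(x, z) \<in> zero_rel X d"
      using * by (auto simp: zero_rel_def)
  qed
qed

lemma refl_dist_eq:
  assumes "pseudometric_on X d" "A \<in> X // zero_rel X d" "B \<in> X // zero_rel X d"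
    "x \<in> A" "y \<in> B"
  shows "refl_dist d A B = d x y"
  unfolding refl_dist_def
proof (rule the_equality)
  show "\<exists>x'\<in>A. \<exists>y'\<in>B. d x y = d x' y'"
    using assms by blast
next
  fix t assume "\<exists>x\<in>A. \<exists>y\<in>B. t = d x y"
  then obtain x' y' where t: "x' \<in> A" "y' \<in> B" "t = d x' y'" by blast
  have "(x, x') \<in> zero_rel X d" "(y, y') \<in> zero_rel X d"
    using quotient_eq_iff[OF equiv_zero_rel[OF assms(1)]] assms t by blast+
  then have m: "x \<in> X" "x' \<in> X" "y \<in> X" "y' \<in> X" "d x x' = 0" "d y y' = 0"
    by (auto simp: zero_rel_def)
  have tri: "d a c \<le> d a b + d b c" and sm: "d a b = d b a" if "a \<in> X" "b \<in> X" "c \<in> X" for a b c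
    using assms(1) that unfolding pseudometric_on_def by blast+
  show "t = d x y"
    using tri[of x x' y] tri[of x' y' y] tri[of x' x y'] tri[of x y y'] sm[of x x' x] sm[of y y' y] m t
    by linarith
qed

end

theory Submission
  imports Defs "HOL-Library.Disjoint_Sets"
begin

text \<open>
  Every partition of \<open>X\<^sup>2\<close> in the theorem is pulled back from the partition of \<open>Q\<^sup>2\<close> into the fibres
  of some function, so that everything happens on the metric reflection.  A permutation is a
  combinatorial self-similarity iff it preserves equality of distances.  If all permutations of
  \<open>Q\<close> do, then either two pairs of points sharing exactly one point have equal distances, and
  moving such a configuration around makes all nonzero distances equal; or two disjoint pairs have
  equal distances and no two adjacent pairs do, which forces \<open>|Q| = 4\<close>, as a fifth point would
  produce adjacent pairs; or all distances are different.  Given this, the condition on cardinalities is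
  equivalent to \<open>Cs = PI\<close>: a self-similarity permutes the blocks and maps each of them to one of
  the same cardinality, and conversely a bijection between two blocks extends to a self-similarity
  exchanging them.
\<close>

section \<open>Functions of two arguments up to relabelling of values\<close>

text \<open>Only the kernel of a function on \<open>S \<times> S\<close> matters, so the real-valued
  \<open>refl_dist d\<close> can be compared with set-valued models.\<close>

definition same_fibres :: "'b set \<Rightarrow> ('b \<Rightarrow> 'b \<Rightarrow> 'c) \<Rightarrow> ('b \<Rightarrow> 'b \<Rightarrow> 'd) \<Rightarrow> bool" where
  "same_fibres S f g \<longleftrightarrow>
     (\<forall>a\<in>S. \<forall>b\<in>S. \<forall>c\<in>S. \<forall>e\<in>S. f a b = f c e \<longleftrightarrow> g a b = g c e)"

definition preserves_fibres :: "'b set \<Rightarrow> ('b \<Rightarrow> 'b \<Rightarrow> 'c) \<Rightarrow> ('b \<Rightarrow> 'b) \<Rightarrow> bool" where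
  "preserves_fibres S f p \<longleftrightarrow> same_fibres S f (\<lambda>a b. f (p a) (p b))"

text \<open>Indexed by a pair of blocks rather than by a value, so that fibres of functions with
  different codomains can be compared without translating values.\<close>

definition fibre :: "'a set set \<Rightarrow> ('a set \<Rightarrow> 'a set \<Rightarrow> 'c) \<Rightarrow> 'a set \<Rightarrow> 'a set \<Rightarrow> ('a \<times> 'a) set" where
  "fibre Q f A B = {(x, y). \<exists>C\<in>Q. \<exists>E\<in>Q. x \<in> C \<and> y \<in> E \<and> f C E = f A B}"

definition fibre_partition :: "'a set set \<Rightarrow> ('a set \<Rightarrow> 'a set \<Rightarrow> 'c) \<Rightarrow> ('a \<times> 'a) set set" where
  "fibre_partition Q f = {fibre Q f A B |A B. A \<in> Q \<and> B \<in> Q}"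

text \<open>
  The fibres of \<open>edge\<close>, \<open>(=)\<close> and \<open>splitting Q\<close> on \<open>Q\<^sup>2\<close> give the blocks of \<open>Q \<otimes>\<^sub>1 Q\<close>, \<open>Q \<otimes>\<^sub>2 Q\<close>
  and, for \<open>|Q| = 4\<close>, of \<open>Q \<otimes>\<^sub>3 Q\<close>.
\<close>

definition edge :: "'b \<Rightarrow> 'b \<Rightarrow> 'b set" where
  "edge a b = (if a = b then {} else {a, b})"

definition splitting :: "'b set \<Rightarrow> 'b \<Rightarrow> 'b \<Rightarrow> 'b set set" where
  "splitting S a b = (if a = b then {} else {{a, b}, S - {a, b}})"

lemma edge_eq_iff:
  "edge a b = edge c e \<longleftrightarrow> (a = b \<longleftrightarrow> c = e) \<and> (a \<noteq> b \<longrightarrow> {a, b} = {c, e})"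
  by (auto simp: edge_def)

text \<open>Among four points, a pair disjoint from \<open>{c, e}\<close> is its complement.
  Splittings thus correspond to the three perfect matchings of the complete graph on
  \<open>S\<close>.\<close>

lemma splitting_eq_iff:
  assumes "card S = 4" "a \<in> S" "b \<in> S" "c \<in> S" "e \<in> S"
  shows "splitting S a b = splitting S c e \<longleftrightarrow>
    (a = b \<longleftrightarrow> c = e) \<and> (a \<noteq> b \<longrightarrow> {a, b} = {c, e} \<or> {a, b} \<inter> {c, e} = {})"
proof (cases "a = b \<or> c = e")
  case True
  then show ?thesis by (auto simp: splitting_def)
next
  case False
  have fin: "finite S" using assms(1) by (simp add: card_ge_0_finite)
  have compl: "{a, b} = S - {c, e} \<longleftrightarrow> {a, b} \<inter> {c, e} = {}"
  proof
    assume "{a, b} \<inter> {c, e} = {}"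
    then have "{a, b} \<subseteq> S - {c, e}" using assms by blast
    moreover have "card {a, b} = card (S - {c, e})"
      using False assms fin by (simp add: card_Diff_subset)
    ultimately show "{a, b} = S - {c, e}"
      using fin by (simp add: card_subset_eq)
  qed blast
  have "{a, b} \<subseteq> S" "{c, e} \<subseteq> S" using assms by auto
  then have "{{a, b}, S - {a, b}} = {{c, e}, S - {c, e}} \<longleftrightarrow> {a, b} = {c, e} \<or> {a, b} = S - {c, e}"
    unfolding doubleton_eq_iff by blast
  then show ?thesis using False compl by (simp add: splitting_def)
qed

lemma preserves_fibres_edge:
  assumes "inj_on p S"
  shows "preserves_fibres S edge p"
  using assms unfolding preserves_fibres_def same_fibres_def edge_eq_iff doubleton_eq_iff
  by (auto simp: inj_on_eq_iff)

lemma preserves_fibres_diag: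
  assumes "inj_on p S"
  shows "preserves_fibres S (=) p"
  using assms unfolding preserves_fibres_def same_fibres_def
  by (auto simp: inj_on_eq_iff)

lemma preserves_fibres_splitting:
  assumes "card S = 4" "p permutes S"
  shows "preserves_fibres S (splitting S) p"
proof -
  have "inj p" using assms(2) by (rule permutes_inj)
  then show ?thesis
    using assms unfolding preserves_fibres_def same_fibres_def
    by (auto simp: splitting_eq_iff permutes_in_image doubleton_eq_iff inj_eq)
qed

text \<open>Preservation depends only on the kernel; as \<open>p\<close> maps \<open>S\<close> into
  itself, the kernels can be compared once more at the images.\<close>

lemma same_fibres_preserves:
  assumes "same_fibres S f g" "preserves_fibres S g p" "p permutes S"
  shows "preserves_fibres S f p"
  unfolding preserves_fibres_def same_fibres_def
proof (intro ballI)
  fix a b c e assume S: "a \<in> S" "b \<in> S" "c \<in> S" "e \<in> S"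
  have "f a b = f c e \<longleftrightarrow> g a b = g c e"
    using assms(1) S unfolding same_fibres_def by blast
  also have "\<dots> \<longleftrightarrow> g (p a) (p b) = g (p c) (p e)"
    using assms(2) S unfolding preserves_fibres_def same_fibres_def by blast
  also have "\<dots> \<longleftrightarrow> f (p a) (p b) = f (p c) (p e)"
    using assms(1) S permutes_in_image[OF assms(3)] unfolding same_fibres_def by blast
  finally show "f a b = f c e \<longleftrightarrow> f (p a) (p b) = f (p c) (p e)" .
qed

section \<open>Self-similarities as permutations preserving equality of distances\<close>

text \<open>The rescaling of distances is forced by \<open>p\<close>: it sends
  \<open>d (p x) (p y)\<close> to \<open>d x y\<close>. Preservation of fibres says exactly that
  this is well defined and injective.\<close>

lemma Cs_iff: "p \<in> Cs X d \<longleftrightarrow> p permutes X \<and> preserves_fibres X d p"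
proof (cases "p permutes X")
  case True
  have px: "p x \<in> X \<longleftrightarrow> x \<in> X" for x using True by (simp add: permutes_in_image)
  have surj: "\<exists>u\<in>X. p u = x" if "x \<in> X" for x
    using that permutes_image[OF True] by (metis imageE)
  have "(\<exists>f. bij_betw f (dist_set X d) (dist_set X d) \<and> (\<forall>x\<in>X. \<forall>y\<in>X. d x y = f (d (p x) (p y))))
    \<longleftrightarrow> preserves_fibres X d p" (is "?L \<longleftrightarrow> ?R")
  proof
    assume ?L
    then obtain f where f: "bij_betw f (dist_set X d) (dist_set X d)"
      "\<And>x y. x \<in> X \<Longrightarrow> y \<in> X \<Longrightarrow> d x y = f (d (p x) (p y))" by blast
    have mem: "d (p x) (p y) \<in> dist_set X d" if "x \<in> X" "y \<in> X" for x y
      using that px unfolding dist_set_def by blast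
    have "inj_on f (dist_set X d)" using f(1) by (rule bij_betw_imp_inj_on)
    then show ?R unfolding preserves_fibres_def same_fibres_def
      using f(2) mem by (metis inj_on_eq_iff)
  next
    assume R: ?R
    then have iff: "d a b = d c e \<longleftrightarrow> d (p a) (p b) = d (p c) (p e)"
      if "a \<in> X" "b \<in> X" "c \<in> X" "e \<in> X" for a b c e
      using that unfolding preserves_fibres_def same_fibres_def by blast
    define f where "f t = (THE s. \<exists>x\<in>X. \<exists>y\<in>X. t = d (p x) (p y) \<and> s = d x y)" for t
    have feq: "f (d (p x) (p y)) = d x y" if "x \<in> X" "y \<in> X" for x y
      unfolding f_def
    proof (rule the_equality)
      show "\<exists>u\<in>X. \<exists>v\<in>X. d (p x) (p y) = d (p u) (p v) \<and> d x y = d u v"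
        using that by blast
    next
      fix s assume "\<exists>u\<in>X. \<exists>v\<in>X. d (p x) (p y) = d (p u) (p v) \<and> s = d u v"
      then obtain u v where "u \<in> X" "v \<in> X" "d (p x) (p y) = d (p u) (p v)" "s = d u v" by blast
      then show "s = d x y" using iff[of x y u v] that by simp
    qed
    \<comment> \<open>Since \<open>p\<close> is onto \<open>X\<close>, every distance is attained at
      a pair of images, so \<open>feq\<close> describes \<open>f\<close> on all of
      \<open>dist_set X d\<close>.\<close>
    have ds: "t \<in> dist_set X d \<longleftrightarrow> (\<exists>x\<in>X. \<exists>y\<in>X. t = d (p x) (p y))" for t
      unfolding dist_set_def using surj px by (auto, metis)
    have "inj_on f (dist_set X d)"
      by (rule inj_onI) (auto simp: ds feq iff)
    moreover have "f ` dist_set X d = dist_set X d"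
    proof
      show "f ` dist_set X d \<subseteq> dist_set X d"
      proof
        fix t assume "t \<in> f ` dist_set X d"
        then obtain x y where "x \<in> X" "y \<in> X" "t = d x y" using ds feq by auto
        then show "t \<in> dist_set X d" unfolding dist_set_def by blast
      qed
      show "dist_set X d \<subseteq> f ` dist_set X d"
      proof
        fix t assume "t \<in> dist_set X d"
        then obtain x y where "x \<in> X" "y \<in> X" "t = f (d (p x) (p y))"
          unfolding dist_set_def using feq by force
        then show "t \<in> f ` dist_set X d" using ds by blast
      qed
    qed
    ultimately show ?L using feq by (intro exI[of _ f]) (simp add: bij_betw_def)
  qed
  then show ?thesis using True by (simp add: Cs_def Sym_def)
qed (simp add: Cs_def Sym_def)

lemma Cs_eq_Sym_iff: "Cs X d = Sym X \<longleftrightarrow> (\<forall>p. p permutes X \<longrightarrow> preserves_fibres X d p)"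
  by (auto simp: set_eq_iff Cs_iff Sym_def)

section \<open>Functions whose fibres all permutations preserve\<close>

text \<open>High transitivity of the symmetric group, for finite and infinite \<open>S\<close>
  alike; it moves one configuration of points to any other of the same shape.\<close>

lemma permutation_of_lists:
  assumes "length xs = length ys" "distinct xs" "distinct ys" "set xs \<subseteq> S" "set ys \<subseteq> S"
  shows "\<exists>p. p permutes S \<and> map p xs = ys"
  using assms
proof (induction xs ys rule: list_induct2)
  case Nil
  show ?case by (auto intro: permutes_id)
next
  case (Cons x xs y ys)
  then obtain p where p: "p permutes S" "map p xs = ys" by auto
  \<comment> \<open>The transposition corrects the value at the new head. On the tail,
    \<open>p z\<close> differs from \<open>p x\<close> by injectivity and from \<open>y\<close>
    because it lies in \<open>ys\<close>.\<close>
  let ?q = "transpose (p x) y \<circ> p"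
  have "?q permutes S"
    using p Cons.prems by (intro permutes_compose permutes_swap_id) (auto simp: permutes_in_image)
  moreover have "?q z = p z" if "z \<in> set xs" for z
  proof -
    have "p z \<noteq> p x" using that Cons.prems p(1) by (auto simp: inj_eq dest: permutes_inj)
    moreover have "p z \<noteq> y" using that Cons.prems p(2) by auto
    ultimately show ?thesis by simp
  qed
  then have "map ?q (x # xs) = y # ys" using p(2) by auto
  ultimately show ?case by (intro exI[of _ ?q] conjI)
qed

text \<open>View \<open>f\<close> as an edge colouring of the complete graph on \<open>S\<close>,
  with one further colour for the diagonal by \<open>diag\<close>. Invariance makes equality of the
  colours of two edges depend only on whether the edges are equal, adjacent or disjoint.\<close>

lemma same_fibres_classification:
  fixes f :: "'b \<Rightarrow> 'b \<Rightarrow> 'c"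
  assumes sym: "\<And>a b. a \<in> S \<Longrightarrow> b \<in> S \<Longrightarrow> f a b = f b a"
    and diag: "\<And>a b c. a \<in> S \<Longrightarrow> b \<in> S \<Longrightarrow> c \<in> S \<Longrightarrow> f a b = f c c \<longleftrightarrow> a = b"
    and inv: "\<And>p. p permutes S \<Longrightarrow> preserves_fibres S f p"
  shows "same_fibres S f edge \<or> same_fibres S f (=) \<or> (card S = 4 \<and> same_fibres S f (splitting S))"
proof -
  have move: "f (p a) (p b) = f (p c) (p e)"
    if "p permutes S" "f a b = f c e" "a \<in> S" "b \<in> S" "c \<in> S" "e \<in> S" for p a b c e
    using inv[OF that(1)] that unfolding preserves_fibres_def same_fibres_def by blast
  have diag': "a = b \<longleftrightarrow> c = e" if "f a b = f c e" "a \<in> S" "b \<in> S" "c \<in> S" "e \<in> S" for a b c e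
    using that diag by metis
  show ?thesis
  proof (cases "\<exists>a\<in>S. \<exists>b\<in>S. \<exists>c\<in>S. distinct [a, b, c] \<and> f a b = f a c")
    case True
    then obtain a b c where abc: "{a, b, c} \<subseteq> S" "distinct [a, b, c]" "f a b = f a c" by auto
    have adj: "f x y = f x z" if xyz: "{x, y, z} \<subseteq> S" "distinct [x, y, z]" for x y z
    proof -
      obtain p where "p permutes S" "map p [a, b, c] = [x, y, z]"
        using permutation_of_lists[of "[a, b, c]" "[x, y, z]" S] abc xyz by auto
      then show ?thesis using move[of p a b a c] abc by auto
    qed
    have adj': "f x y = f x z" if "x \<in> S" "y \<in> S" "z \<in> S" "x \<noteq> y" "x \<noteq> z" for x y z
      using adj[of x y z] that by (cases "y = z") auto
    \<comment> \<open>Edges without a given common vertex are linked through the edge from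
      \<open>x\<close> to \<open>z\<close>, which is adjacent to both.\<close>
    have "f x y = f z w" if "x \<in> S" "y \<in> S" "z \<in> S" "w \<in> S" "x \<noteq> y" "z \<noteq> w" for x y z w
    proof (cases "x = z")
      case False
      then have "f x y = f x z" "f z x = f z w" using adj'[of x y z] adj'[of z x w] that by simp_all
      then show ?thesis using sym[of x z] that by simp
    qed (use adj'[of x y w] that in simp)
    then have "same_fibres S f (=)"
      unfolding same_fibres_def using diag by (metis (full_types))
    then show ?thesis by blast
  next
    case False
    \<comment> \<open>The edges at one vertex now have pairwise different colours; the degenerate
      case \<open>z = x\<close> is excluded by \<open>diag'\<close>.\<close>
    then have nadj: "y = z" if "f x y = f x z" "x \<in> S" "y \<in> S" "z \<in> S" "x \<noteq> y" for x y z
      using that diag'[of x y x z] by auto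
    have cases4: "{a, b} = {c, e} \<or> {a, b} \<inter> {c, e} = {}"
      if eq: "f a b = f c e" and S: "a \<in> S" "b \<in> S" "c \<in> S" "e \<in> S" and "a \<noteq> b" for a b c e
    proof -
      have "a = c \<Longrightarrow> b = e" using nadj[of a b e] eq S \<open>a \<noteq> b\<close> by metis
      moreover have "a = e \<Longrightarrow> b = c" using nadj[of a b c] sym[of c e] eq S \<open>a \<noteq> b\<close> by metis
      moreover have "b = c \<Longrightarrow> a = e" using nadj[of b a e] sym[of a b] eq S \<open>a \<noteq> b\<close> by metis
      moreover have "b = e \<Longrightarrow> a = c"
        using nadj[of b a c] sym[of a b] sym[of c e] eq S \<open>a \<noteq> b\<close> by metis
      ultimately show ?thesis by blast
    qed
    have eqI: "f a b = f c e" if "{a, b} = {c, e}" "a \<in> S" "b \<in> S" for a b c e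
      using that sym by (auto simp: doubleton_eq_iff)
    show ?thesis
    proof (cases "\<exists>a\<in>S. \<exists>b\<in>S. \<exists>c\<in>S. \<exists>e\<in>S. distinct [a, b, c, e] \<and> f a b = f c e")
      case True
      then obtain a b c e where abce: "{a, b, c, e} \<subseteq> S" "distinct [a, b, c, e]" "f a b = f c e"
        by auto
      have disj: "f x y = f z w" if xyzw: "{x, y, z, w} \<subseteq> S" "distinct [x, y, z, w]" for x y z w
      proof -
        obtain p where "p permutes S" "map p [a, b, c, e] = [x, y, z, w]"
          using permutation_of_lists[of "[a, b, c, e]" "[x, y, z, w]" S] abce xyzw by auto
        then show ?thesis using move[of p a b c e] abce by auto
      qed
      have "v \<in> {a, b, c, e}" if "v \<in> S" for v
      proof (rule ccontr)
        assume v: "v \<notin> {a, b, c, e}"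
        \<comment> \<open>Together with \<open>f a b = f c e\<close>, this gives equal colours to
          two different edges at \<open>a\<close>.\<close>
        have "f c e = f a v" using disj[of c e a v] v abce that by auto
        then show False using nadj[of a b v] abce that v by auto
      qed
      then have "S = {a, b, c, e}" using abce(1) by blast
      then have four: "card S = 4" using abce(2) by simp
      have "f x y = f z w \<longleftrightarrow> splitting S x y = splitting S z w"
        if "x \<in> S" "y \<in> S" "z \<in> S" "w \<in> S" for x y z w
      proof (cases "x = y \<or> z = w")
        case True
        then show ?thesis
          using that diag[of x y z] diag[of z w x] by (auto simp: splitting_eq_iff four)
      next
        case False
        then show ?thesis
          using that cases4[of x y z w] eqI[of x y z w] disj[of x y z w]
          by (auto simp: splitting_eq_iff four)
      qed
      then show ?thesis using four by (simp add: same_fibres_def)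
    next
      case False
      have "f x y = f z w \<longleftrightarrow> edge x y = edge z w"
        if "x \<in> S" "y \<in> S" "z \<in> S" "w \<in> S" for x y z w
      proof (cases "x = y \<or> z = w")
        case True
        then show ?thesis using that diag[of x y z] diag[of z w x] by (auto simp: edge_eq_iff)
      next
        case ne: False
        have "f x y \<noteq> f z w" if "distinct [x, y, z, w]"
          using that False \<open>x \<in> S\<close> \<open>y \<in> S\<close> \<open>z \<in> S\<close> \<open>w \<in> S\<close> by blast
        \<comment> \<open>Disjoint edges of one colour are excluded in this case, so
          \<open>cases4\<close> leaves only equal edges.\<close>
        then have "{x, y} \<inter> {z, w} \<noteq> {}" if "f x y = f z w"
          using that ne by auto
        then show ?thesis
          using that ne cases4[of x y z w] eqI[of x y z w] unfolding edge_eq_iff by blast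
      qed
      then show ?thesis by (simp add: same_fibres_def)
    qed
  qed
qed

section \<open>The tensor partitions as fibre partitions\<close>

lemma block_unique:
  assumes "partition_on X Q" "A \<in> Q" "B \<in> Q" "x \<in> A" "x \<in> B"
  shows "A = B"
  using assms by (auto simp: partition_on_def disjoint_def)

lemma mem_fibre_iff:
  assumes "partition_on X Q" "C \<in> Q" "E \<in> Q" "x \<in> C" "y \<in> E"
  shows "(x, y) \<in> fibre Q f A B \<longleftrightarrow> f C E = f A B"
  using assms block_unique[OF assms(1)] unfolding fibre_def by blast

text \<open>Every block has a point, and membership of a point of \<open>C \<times> E\<close> in a
  fibre decides an equality of values; so the partition determines the kernel.\<close>

lemma fibre_partition_eq_iff:
  assumes Q: "partition_on X Q"
  shows "fibre_partition Q f = fibre_partition Q g \<longleftrightarrow> same_fibres Q f g"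
proof
  assume eq: "fibre_partition Q f = fibre_partition Q g"
  show "same_fibres Q f g"
    unfolding same_fibres_def
  proof (intro ballI)
    fix A B C E assume ABCE: "A \<in> Q" "B \<in> Q" "C \<in> Q" "E \<in> Q"
    then obtain x y u v where m: "x \<in> A" "y \<in> B" "u \<in> C" "v \<in> E"
      using Q unfolding partition_on_def by (metis ex_in_conv)
    have "fibre Q f A B \<in> fibre_partition Q f"
      using ABCE unfolding fibre_partition_def by blast
    \<comment> \<open>The equal fibre of \<open>g\<close> may be indexed by another pair of blocks;
      testing it at \<open>(x, y)\<close> shows that \<open>g\<close> has the same value there as at
      \<open>A\<close>, \<open>B\<close>.\<close>
    then obtain A' B' where *: "fibre Q f A B = fibre Q g A' B'" "A' \<in> Q" "B' \<in> Q"
      unfolding eq unfolding fibre_partition_def by blast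
    have "(x, y) \<in> fibre Q f A B" unfolding mem_fibre_iff[OF Q ABCE(1,2) m(1,2)] ..
    then have AB: "g A B = g A' B'" unfolding *(1) mem_fibre_iff[OF Q ABCE(1,2) m(1,2)] .
    have "f C E = f A B \<longleftrightarrow> (u, v) \<in> fibre Q f A B"
      unfolding mem_fibre_iff[OF Q ABCE(3,4) m(3,4)] ..
    also have "\<dots> \<longleftrightarrow> g C E = g A B"
      unfolding *(1) mem_fibre_iff[OF Q ABCE(3,4) m(3,4)] AB ..
    finally show "f A B = f C E \<longleftrightarrow> g A B = g C E" by auto
  qed
next
  assume "same_fibres Q f g"
  then have "fibre Q f A B = fibre Q g A B" if "A \<in> Q" "B \<in> Q" for A B
    using that unfolding same_fibres_def fibre_def by blast
  then show "fibre_partition Q f = fibre_partition Q g"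
    unfolding fibre_partition_def by blast
qed

lemma fibre_partition_singleton: "fibre_partition {A} f = {A \<times> A}"
  by (auto simp: fibre_partition_def fibre_def)

lemma fibre_diag:
  assumes "\<And>C E. C \<in> Q \<Longrightarrow> E \<in> Q \<Longrightarrow> f C E = f A A \<longleftrightarrow> C = E"
  shows "fibre Q f A A = diag_block Q"
  using assms unfolding fibre_def diag_block_def by auto

lemma fibre_edge:
  assumes "A \<in> Q" "B \<in> Q" "A \<noteq> B"
  shows "fibre Q edge A B = sym_prod A B"
  using assms unfolding fibre_def sym_prod_def edge_eq_iff doubleton_eq_iff by auto

text \<open>For empty \<open>Q\<close> this would fail: \<open>tensor1 Q\<close> would contain the
  empty diagonal block, while there are no fibres.\<close>

lemma tensor1_eq_fibre_partition:
  assumes "Q \<noteq> {}"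
  shows "tensor1 Q = fibre_partition Q edge"
proof (cases "card Q = 1")
  case True
  then obtain A where "Q = {A}" by (auto simp: card_1_singleton_iff)
  then show ?thesis by (simp add: tensor1_def fibre_partition_singleton)
next
  case False
  have diag: "fibre Q edge A A = diag_block Q" for A
    by (rule fibre_diag) (auto simp: edge_eq_iff)
  have "fibre_partition Q edge = {fibre Q edge A A |A. A \<in> Q}
      \<union> {fibre Q edge A B |A B. A \<in> Q \<and> B \<in> Q \<and> A \<noteq> B}"
    unfolding fibre_partition_def by blast
  also have "{fibre Q edge A A |A. A \<in> Q} = {diag_block Q}"
    using assms diag by auto
  also have "{fibre Q edge A B |A B. A \<in> Q \<and> B \<in> Q \<and> A \<noteq> B}
      = {sym_prod A B |A B. A \<in> Q \<and> B \<in> Q \<and> A \<noteq> B}"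
    using fibre_edge[of _ Q] by metis
  finally show ?thesis using False by (simp add: tensor1_def)
qed

lemma tensor2_eq_fibre_partition:
  assumes Q: "partition_on X Q" and "Q \<noteq> {}"
  shows "tensor2 Q = fibre_partition Q (=)"
proof (cases "card Q = 1")
  case True
  then obtain A where "Q = {A}" by (auto simp: card_1_singleton_iff)
  then show ?thesis by (simp add: tensor2_def fibre_partition_singleton)
next
  case False
  \<comment> \<open>Two different blocks ensure that the off-diagonal fibre occurs. An infinite
    \<open>Q\<close>, having \<open>card Q = 0\<close>, also falls into this case.\<close>
  then obtain A B where AB: "A \<in> Q" "B \<in> Q" "A \<noteq> B"
    using assms(2) by (metis card_1_singleton_iff is_singletonI' is_singleton_def One_nat_def)
  have diag: "fibre Q (=) C C = diag_block Q" for C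
    by (rule fibre_diag) auto
  \<comment> \<open>Here disjointness of the blocks enters: points of two different blocks have no
    block in common.\<close>
  have off: "fibre Q (=) C E = \<Union>Q \<times> \<Union>Q - diag_block Q" if "C \<noteq> E" for C E
  proof -
    have "(\<exists>F\<in>Q. \<exists>G\<in>Q. x \<in> F \<and> y \<in> G \<and> F \<noteq> G) \<longleftrightarrow>
        x \<in> \<Union>Q \<and> y \<in> \<Union>Q \<and> \<not> (\<exists>F\<in>Q. x \<in> F \<and> y \<in> F)" for x y
    proof
      assume "\<exists>F\<in>Q. \<exists>G\<in>Q. x \<in> F \<and> y \<in> G \<and> F \<noteq> G"
      then obtain F G where FG: "F \<in> Q" "G \<in> Q" "x \<in> F" "y \<in> G" "F \<noteq> G" by blast
      then have "H = F \<and> H = G" if "H \<in> Q" "x \<in> H" "y \<in> H" for H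
        using block_unique[OF Q, of H F x] block_unique[OF Q, of H G y] that by simp
      then show "x \<in> \<Union>Q \<and> y \<in> \<Union>Q \<and> \<not> (\<exists>F\<in>Q. x \<in> F \<and> y \<in> F)" using FG by blast
    qed blast
    then show ?thesis using that unfolding fibre_def diag_block_def by auto
  qed
  have "fibre Q (=) C E \<in> {diag_block Q, \<Union>Q \<times> \<Union>Q - diag_block Q}" for C E
    using diag off by (cases "C = E") auto
  moreover have "diag_block Q \<in> fibre_partition Q (=)"
    unfolding fibre_partition_def using diag[of A] AB by blast
  moreover have "\<Union>Q \<times> \<Union>Q - diag_block Q \<in> fibre_partition Q (=)"
    unfolding fibre_partition_def using off[of A B] AB by blast
  ultimately have "fibre_partition Q (=) = {diag_block Q, \<Union>Q \<times> \<Union>Q - diag_block Q}"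
    unfolding fibre_partition_def by blast
  then show ?thesis using False by (simp add: tensor2_def)
qed

text \<open>The matching of \<open>A\<close> with \<open>B\<close> and of \<open>C\<close> with
  \<open>D\<close> is given by exactly four ordered pairs of blocks, the two orientations of its two
  edges.\<close>

lemma fibre_splitting:
  assumes "distinct [A, B, C, D]" "Q = {A, B, C, D}"
  shows "fibre Q (splitting Q) A B = sym_prod A B \<union> sym_prod C D"
proof -
  have "card Q = 4" using assms by simp
  then have *: "splitting Q E F = splitting Q A B \<longleftrightarrow>
      (E = A \<and> F = B) \<or> (E = B \<and> F = A) \<or> (E = C \<and> F = D) \<or> (E = D \<and> F = C)"
    if "E \<in> Q" "F \<in> Q" for E F
  proof -
    have "E = A \<or> E = B \<or> E = C \<or> E = D" "F = A \<or> F = B \<or> F = C \<or> F = D"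
      using that assms(2) by auto
    moreover have "A \<noteq> B" "A \<noteq> C" "A \<noteq> D" "B \<noteq> C" "B \<noteq> D" "C \<noteq> D"
      using assms(1) by auto
    moreover have "A \<in> Q" "B \<in> Q" using assms(2) by auto
    ultimately show ?thesis
      unfolding splitting_eq_iff[OF \<open>card Q = 4\<close> that \<open>A \<in> Q\<close> \<open>B \<in> Q\<close>]
      by (elim disjE) (simp_all add: doubleton_eq_iff)
  qed
  have "fibre Q (splitting Q) A B =
      {(x, y). \<exists>E\<in>Q. \<exists>F\<in>Q. x \<in> E \<and> y \<in> F \<and>
        ((E = A \<and> F = B) \<or> (E = B \<and> F = A) \<or> (E = C \<and> F = D) \<or> (E = D \<and> F = C))}"
    unfolding fibre_def by (simp add: * cong: bex_cong)
  also have "\<dots> = sym_prod A B \<union> sym_prod C D"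
    unfolding assms(2) sym_prod_def by auto
  finally show ?thesis .
qed

lemma tensor3_eq_fibre_partition:
  assumes "card Q = 4"
  shows "tensor3 Q = fibre_partition Q (splitting Q)"
proof -
  obtain xs where "set xs = Q" "distinct xs" "length xs = 4"
    using assms finite_distinct_list[of Q] by (metis card.infinite distinct_card zero_neq_numeral)
  then obtain A B C D where Q: "Q = {A, B, C, D}" and dis: "distinct [A, B, C, D]"
    by (auto simp: length_Suc_conv numeral_eq_Suc)
  have diag: "fibre Q (splitting Q) E E = diag_block Q" for E
    by (rule fibre_diag) (auto simp: splitting_def)
  \<comment> \<open>This is \<open>fibre_splitting\<close> for an arbitrary renumbering of the four
    blocks; it serves all twelve ordered pairs of different blocks.\<close>
  have fib: "fibre Q (splitting Q) E F = sym_prod E F \<union> sym_prod G H"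
    if "distinct [E, F, G, H]" "{E, F, G, H} = {A, B, C, D}" for E F G H
    using fibre_splitting[OF that(1)] that(2) Q by metis
  have "fibre_partition Q (splitting Q) =
    {diag_block Q, sym_prod A B \<union> sym_prod C D, sym_prod A C \<union> sym_prod B D,
     sym_prod A D \<union> sym_prod B C}" (is "_ = ?T")
  proof
    have "fibre Q (splitting Q) E F \<in> ?T" if EF: "E \<in> Q" "F \<in> Q" for E F
    proof (cases "E = F")
      case False
      have ne: "A \<noteq> B" "A \<noteq> C" "A \<noteq> D" "B \<noteq> C" "B \<noteq> D" "C \<noteq> D" using dis by auto
      have
        "fibre Q (splitting Q) A B = sym_prod A B \<union> sym_prod C D"
        "fibre Q (splitting Q) B A = sym_prod B A \<union> sym_prod C D"
        "fibre Q (splitting Q) C D = sym_prod C D \<union> sym_prod A B"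
        "fibre Q (splitting Q) D C = sym_prod D C \<union> sym_prod A B"
        "fibre Q (splitting Q) A C = sym_prod A C \<union> sym_prod B D"
        "fibre Q (splitting Q) C A = sym_prod C A \<union> sym_prod B D"
        "fibre Q (splitting Q) B D = sym_prod B D \<union> sym_prod A C"
        "fibre Q (splitting Q) D B = sym_prod D B \<union> sym_prod A C"
        "fibre Q (splitting Q) A D = sym_prod A D \<union> sym_prod B C"
        "fibre Q (splitting Q) D A = sym_prod D A \<union> sym_prod B C"
        "fibre Q (splitting Q) B C = sym_prod B C \<union> sym_prod A D"
        "fibre Q (splitting Q) C B = sym_prod C B \<union> sym_prod A D"
        by (rule fib; use ne in auto)+
      moreover have "E = A \<or> E = B \<or> E = C \<or> E = D" "F = A \<or> F = B \<or> F = C \<or> F = D"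
        using EF Q by auto
      ultimately show ?thesis
        using False by (elim disjE) (simp_all add: sym_prod_commute Un_commute)
    qed (simp add: diag)
    then show "fibre_partition Q (splitting Q) \<subseteq> ?T"
      unfolding fibre_partition_def by blast
    have "A \<in> Q" "B \<in> Q" "C \<in> Q" "D \<in> Q" using Q by auto
    moreover have "fibre Q (splitting Q) A B = sym_prod A B \<union> sym_prod C D"
      "fibre Q (splitting Q) A C = sym_prod A C \<union> sym_prod B D"
      "fibre Q (splitting Q) A D = sym_prod A D \<union> sym_prod B C"
      by (rule fib; use dis in auto)+
    ultimately show "?T \<subseteq> fibre_partition Q (splitting Q)"
      using diag[of A] unfolding fibre_partition_def by blast
  qed
  then show ?thesis using tensor3_eq[OF dis] Q by simp
qed

section \<open>Passage between the space and its metric reflection\<close>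

context
  fixes X :: "'a set" and d :: "'a \<Rightarrow> 'a \<Rightarrow> real"
  assumes d: "pseudometric_on X d"
begin

lemma partition_on_blocks: "partition_on X (X // zero_rel X d)"
  by (rule partition_on_quotient[OF equiv_zero_rel[OF d]])

lemma mem_block_iff:
  assumes "A \<in> X // zero_rel X d" "x \<in> A"
  shows "y \<in> A \<longleftrightarrow> y \<in> X \<and> d x y = 0"
proof -
  note eqv = equiv_zero_rel[OF d]
  have "y \<in> A \<longleftrightarrow> (x, y) \<in> zero_rel X d"
    using in_quotient_imp_in_rel[OF eqv assms(1), of x y] in_quotient_imp_closed[OF eqv assms, of y]
      assms(2) by blast
  moreover have "x \<in> X" using in_quotient_imp_subset[OF eqv assms(1)] assms(2) by blast
  ultimately show ?thesis by (simp add: zero_rel_def)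
qed

lemma block_obtain:
  assumes "x \<in> X"
  obtains A where "A \<in> X // zero_rel X d" "x \<in> A"
  using assms partition_on_blocks unfolding partition_on_def by blast

lemma block_nonempty:
  assumes "A \<in> X // zero_rel X d"
  obtains x where "x \<in> A" "x \<in> X"
  using assms partition_on_blocks unfolding partition_on_def by (metis Union_iff ex_in_conv)

text \<open>By \<open>refl_dist_eq\<close>, \<open>d\<close> is the pullback of
  \<open>refl_dist d\<close> along the map from points to blocks, and so are its level sets.\<close>

lemma dist_partition_eq_fibre_partition:
  "dist_partition X d = fibre_partition (X // zero_rel X d) (refl_dist d)"
proof -
  let ?Q = "X // zero_rel X d"
  have level: "{(u, v) \<in> X \<times> X. d u v = d x y} = fibre ?Q (refl_dist d) A B"
    if AB: "A \<in> ?Q" "B \<in> ?Q" "x \<in> A" "y \<in> B" for A B x y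
  proof -
    have "u \<in> X \<and> v \<in> X \<and> d u v = d x y \<longleftrightarrow>
        (\<exists>C\<in>?Q. \<exists>E\<in>?Q. u \<in> C \<and> v \<in> E \<and> refl_dist d C E = d x y)" for u v
      by (metis block_obtain refl_dist_eq[OF d] mem_block_iff)
    then show ?thesis
      unfolding fibre_def refl_dist_eq[OF d AB] by auto
  qed
  show ?thesis
  proof
    show "dist_partition X d \<subseteq> fibre_partition ?Q (refl_dist d)"
    proof
      fix P assume "P \<in> dist_partition X d"
      then obtain x y where xy: "x \<in> X" "y \<in> X" "P = {(u, v) \<in> X \<times> X. d u v = d x y}"
        unfolding dist_partition_def dist_set_def by blast
      then obtain A B where "A \<in> ?Q" "B \<in> ?Q" "x \<in> A" "y \<in> B" by (metis block_obtain)
      then show "P \<in> fibre_partition ?Q (refl_dist d)"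
        using level[of A B x y] xy(3) unfolding fibre_partition_def by blast
    qed
    show "fibre_partition ?Q (refl_dist d) \<subseteq> dist_partition X d"
    proof
      fix P assume "P \<in> fibre_partition ?Q (refl_dist d)"
      then obtain A B where AB: "A \<in> ?Q" "B \<in> ?Q" "P = fibre ?Q (refl_dist d) A B"
        unfolding fibre_partition_def by blast
      then obtain x y where "x \<in> A" "x \<in> X" "y \<in> B" "y \<in> X" by (metis block_nonempty)
      then show "P \<in> dist_partition X d"
        using level[of A B x y] AB unfolding dist_partition_def dist_set_def by blast
    qed
  qed
qed

text \<open>Both sides concern only the kernel of \<open>refl_dist d\<close> on \<open>Q\<close>.
  One direction is the classification, the other the invariance of the three models under
  permutations.\<close>

lemma Cs_refl_dist_eq_Sym_iff:
  assumes "X \<noteq> {}" and Q: "Q = X // zero_rel X d"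
  shows "Cs Q (refl_dist d) = Sym Q \<longleftrightarrow>
    dist_partition X d \<in> {tensor1 Q, tensor2 Q} \<union> (if card Q = 4 then {tensor3 Q} else {})"
proof -
  have part: "partition_on X Q" using partition_on_blocks Q by simp
  have "Q \<noteq> {}" using assms by (auto simp: quotient_def)
  then have fib: "tensor1 Q = fibre_partition Q edge" "tensor2 Q = fibre_partition Q (=)"
    "card Q = 4 \<Longrightarrow> tensor3 Q = fibre_partition Q (splitting Q)"
    "dist_partition X d = fibre_partition Q (refl_dist d)"
    using tensor1_eq_fibre_partition tensor2_eq_fibre_partition[OF part]
      tensor3_eq_fibre_partition dist_partition_eq_fibre_partition Q by blast+
  have "dist_partition X d \<in> {tensor1 Q, tensor2 Q} \<union> (if card Q = 4 then {tensor3 Q} else {}) \<longleftrightarrow>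
      same_fibres Q (refl_dist d) edge \<or> same_fibres Q (refl_dist d) (=) \<or>
      (card Q = 4 \<and> same_fibres Q (refl_dist d) (splitting Q))"
    by (simp add: fib fibre_partition_eq_iff[OF part])
  also have "\<dots> \<longleftrightarrow> (\<forall>p. p permutes Q \<longrightarrow> preserves_fibres Q (refl_dist d) p)"
  proof
    assume "\<forall>p. p permutes Q \<longrightarrow> preserves_fibres Q (refl_dist d) p"
    moreover have "refl_dist d A B = refl_dist d B A" if AB: "A \<in> Q" "B \<in> Q" for A B
    proof -
      obtain x y where m: "x \<in> A" "x \<in> X" "y \<in> B" "y \<in> X"
        using AB Q by (metis block_nonempty)
      then have "d x y = d y x"
        using d unfolding pseudometric_on_def by blast
      then show ?thesis using refl_dist_eq[OF d] AB Q m by metis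
    qed
    moreover have "refl_dist d A B = refl_dist d C C \<longleftrightarrow> A = B"
      if ABC: "A \<in> Q" "B \<in> Q" "C \<in> Q" for A B C
    proof -
      obtain x y z where m: "x \<in> A" "x \<in> X" "y \<in> B" "y \<in> X" "z \<in> C" "z \<in> X"
        using ABC Q by (metis block_nonempty)
      have "d z z = 0" using d m unfolding pseudometric_on_def by blast
      then have "refl_dist d A B = refl_dist d C C \<longleftrightarrow> d x y = 0"
        using refl_dist_eq[OF d] ABC Q m by metis
      also have "\<dots> \<longleftrightarrow> y \<in> A" using mem_block_iff ABC Q m by metis
      also have "\<dots> \<longleftrightarrow> A = B" using block_unique[OF part, of A B y] ABC m by blast
      finally show ?thesis .
    qed
    ultimately show "same_fibres Q (refl_dist d) edge \<or> same_fibres Q (refl_dist d) (=) \<or>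
      (card Q = 4 \<and> same_fibres Q (refl_dist d) (splitting Q))"
      using same_fibres_classification[of Q "refl_dist d"] by blast
  next
    assume R: "same_fibres Q (refl_dist d) edge \<or> same_fibres Q (refl_dist d) (=) \<or>
      (card Q = 4 \<and> same_fibres Q (refl_dist d) (splitting Q))"
    show "\<forall>p. p permutes Q \<longrightarrow> preserves_fibres Q (refl_dist d) p"
    proof (intro allI impI)
      fix p assume p: "p permutes Q"
      then have inj: "inj_on p Q" by (rule permutes_inj_on)
      show "preserves_fibres Q (refl_dist d) p"
        using R
        by (auto intro: same_fibres_preserves[OF _ preserves_fibres_edge[OF inj] p]
            same_fibres_preserves[OF _ preserves_fibres_diag[OF inj] p]
            same_fibres_preserves[OF _ preserves_fibres_splitting[OF _ p] p])
    qed
  qed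
  finally show ?thesis by (simp add: Cs_eq_Sym_iff)
qed

section \<open>Self-similarities and the cardinalities of the blocks\<close>

text \<open>Moving points inside their blocks changes no distance at all.\<close>

lemma PI_subset_Cs: "PI X d \<subseteq> Cs X d"
proof
  fix p assume "p \<in> PI X d"
  then have p: "p permutes X" "\<And>x. x \<in> X \<Longrightarrow> d x (p x) = 0" by (auto simp: PI_def Sym_def)
  have "d (p x) (p y) = d x y" if "x \<in> X" "y \<in> X" for x y
  proof -
    obtain A B where AB: "A \<in> X // zero_rel X d" "B \<in> X // zero_rel X d" "x \<in> A" "y \<in> B"
      by (metis block_obtain \<open>x \<in> X\<close> \<open>y \<in> X\<close>)
    then have "p x \<in> A" "p y \<in> B"
      using p that mem_block_iff[OF AB(1,3)] mem_block_iff[OF AB(2,4)] permutes_in_image[OF p(1)]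
      by blast+
    then show ?thesis using AB refl_dist_eq[OF d] by metis
  qed
  then show "p \<in> Cs X d" using p(1) by (simp add: Cs_iff preserves_fibres_def same_fibres_def)
qed

lemma Cs_subset_PI:
  assumes "\<And>A B. A \<in> X // zero_rel X d \<Longrightarrow> B \<in> X // zero_rel X d \<Longrightarrow> A \<approx> B \<Longrightarrow> A = B"
  shows "Cs X d \<subseteq> PI X d"
proof
  fix p assume "p \<in> Cs X d"
  then have p: "p permutes X" and iff: "\<And>x y u v. x \<in> X \<Longrightarrow> y \<in> X \<Longrightarrow> u \<in> X \<Longrightarrow> v \<in> X \<Longrightarrow>
      d x y = d u v \<longleftrightarrow> d (p x) (p y) = d (p u) (p v)"
    by (auto simp: Cs_iff preserves_fibres_def same_fibres_def)
  have d0: "d x x = 0" if "x \<in> X" for x using d that unfolding pseudometric_on_def by blast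
  \<comment> \<open>Comparison with the pair \<open>(x, x)\<close>, which has distance 0 before and
    after applying \<open>p\<close>. Hence \<open>p\<close> maps the block of \<open>x\<close> onto
    the block of \<open>p x\<close>.\<close>
  have zero: "d (p x) (p y) = 0 \<longleftrightarrow> d x y = 0" if "x \<in> X" "y \<in> X" for x y
    using iff[of x y x x] that d0 p by (auto simp: permutes_in_image)
  have "d x (p x) = 0" if x: "x \<in> X" for x
  proof -
    have px: "p x \<in> X" using x p by (simp add: permutes_in_image)
    obtain A B where AB: "A \<in> X // zero_rel X d" "B \<in> X // zero_rel X d" "x \<in> A" "p x \<in> B"
      using x px by (metis block_obtain)
    have "p ` A = B"
    proof
      show "p ` A \<subseteq> B"
      proof clarify
        fix z assume "z \<in> A"
        then have "z \<in> X" "d x z = 0" using AB mem_block_iff by blast+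
        then show "p z \<in> B"
          using mem_block_iff[OF AB(2,4), of "p z"] zero[of x z] x p by (simp add: permutes_in_image)
      qed
      show "B \<subseteq> p ` A"
      proof
        fix y assume y: "y \<in> B"
        then have "y \<in> X" "d (p x) y = 0" using AB mem_block_iff by blast+
        moreover obtain z where "z \<in> X" "y = p z"
          using permutes_image[OF p] \<open>y \<in> X\<close> by blast
        ultimately show "y \<in> p ` A"
          using mem_block_iff[OF AB(1,3), of z] zero[of x z] x by blast
      qed
    qed
    moreover have "inj_on p A" using p by (rule permutes_inj_on)
    ultimately have "A \<approx> B" unfolding eqpoll_def bij_betw_def by blast
    then have "A = B" using assms AB by blast
    then show ?thesis using AB mem_block_iff by blast
  qed
  then show "p \<in> PI X d" using p by (simp add: PI_def Sym_def)
qed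

text \<open>Two different equipotent blocks could be exchanged along a bijection. This covers a
  transposition of blocks, a self-similarity by \<open>Sym\<close>, so it is one of \<open>X\<close>
  itself, although it moves points out of their blocks.\<close>

lemma eqpoll_blocks_imp_eq:
  assumes Sym: "Cs (X // zero_rel X d) (refl_dist d) = Sym (X // zero_rel X d)"
    and PI: "Cs X d \<subseteq> PI X d"
    and AB: "A \<in> X // zero_rel X d" "B \<in> X // zero_rel X d" "A \<approx> B"
  shows "A = B"
proof (rule ccontr)
  assume "A \<noteq> B"
  let ?Q = "X // zero_rel X d"
  note uniq = block_unique[OF partition_on_blocks]
  have AX: "A \<subseteq> X" "B \<subseteq> X" using AB(1,2) partition_on_blocks by (auto simp: partition_on_def)
  have dis: "x \<in> A \<Longrightarrow> x \<notin> B" for x using uniq AB(1,2) \<open>A \<noteq> B\<close> by blast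
  obtain h where h: "bij_betw h A B" using AB(3) by (auto simp: eqpoll_def)
  let ?g = "inv_into A h"
  have hB: "h x \<in> B" "?g (h x) = x" if "x \<in> A" for x
    using h that by (auto simp: bij_betw_def)
  have gA: "?g x \<in> A" "h (?g x) = x" if "x \<in> B" for x
    using h that by (auto simp: bij_betw_def inv_into_into f_inv_into_f)
  \<comment> \<open>Using \<open>h\<close> one way and its inverse the other way makes
    \<open>p\<close> an involution, hence a bijection.\<close>
  define p where "p x = (if x \<in> A then h x else if x \<in> B then ?g x else x)" for x
  have pp: "p (p x) = x" for x using hB[of x] gA[of x] dis[of x] dis[of "h x"] by (auto simp: p_def)
  have "p permutes X"
  proof (rule bij_imp_permutes)
    have "p x \<in> X" if "x \<in> X" for x using that hB gA AX by (auto simp: p_def)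
    then show "bij_betw p X X" using pp by (intro bij_betw_byWitness[of X p p X]) auto
    show "p x = x" if "x \<notin> X" for x using that AX by (auto simp: p_def)
  qed
  let ?t = "transpose A B"
  have pt: "?t C \<in> ?Q" "p x \<in> ?t C" if "C \<in> ?Q" "x \<in> C" for C x
  proof -
    show "?t C \<in> ?Q" using that AB by (auto simp: transpose_def)
    show "p x \<in> ?t C"
      using that hB gA dis uniq[OF _ AB(1), of C x] uniq[OF _ AB(2), of C x]
      by (auto simp: p_def transpose_def)
  qed
  have "?t \<in> Cs ?Q (refl_dist d)"
    unfolding Sym using AB by (simp add: Sym_def permutes_swap_id)
  then have t: "refl_dist d C E = refl_dist d F G \<longleftrightarrow>
      refl_dist d (?t C) (?t E) = refl_dist d (?t F) (?t G)"
    if "C \<in> ?Q" "E \<in> ?Q" "F \<in> ?Q" "G \<in> ?Q" for C E F G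
    using that by (simp add: Cs_iff preserves_fibres_def same_fibres_def)
  have "preserves_fibres X d p"
    unfolding preserves_fibres_def same_fibres_def
  proof (intro ballI)
    fix x y u v assume "x \<in> X" "y \<in> X" "u \<in> X" "v \<in> X"
    then obtain C E F G where m: "C \<in> ?Q" "x \<in> C" "E \<in> ?Q" "y \<in> E" "F \<in> ?Q" "u \<in> F" "G \<in> ?Q" "v \<in> G"
      by (metis block_obtain)
    \<comment> \<open>As \<open>p\<close> lies over \<open>?t\<close>, distances before and after
      \<open>p\<close> are read off from the blocks, where \<open>t\<close> applies.\<close>
    have "d x y = refl_dist d C E" "d u v = refl_dist d F G"
      "d (p x) (p y) = refl_dist d (?t C) (?t E)" "d (p u) (p v) = refl_dist d (?t F) (?t G)"
      using m pt[OF m(1,2)] pt[OF m(3,4)] pt[OF m(5,6)] pt[OF m(7,8)]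
      by (simp_all add: refl_dist_eq[OF d])
    then show "d x y = d u v \<longleftrightarrow> d (p x) (p y) = d (p u) (p v)" using t m by simp
  qed
  then have "p \<in> PI X d" using PI \<open>p permutes X\<close> by (auto simp: Cs_iff)
  obtain x where "x \<in> A" "x \<in> X" using AB(1) by (rule block_nonempty)
  then have "d x (p x) = 0" "p x \<in> X"
    using \<open>p \<in> PI X d\<close> permutes_in_image[OF \<open>p permutes X\<close>] by (auto simp: PI_def)
  then have "p x \<in> A" using mem_block_iff[OF AB(1) \<open>x \<in> A\<close>] by blast
  moreover have "p x \<in> B" using \<open>x \<in> A\<close> hB by (simp add: p_def)
  ultimately show False using dis by blast
qed

end

theorem theorem5p7:
  fixes X :: "'a set" and d :: "'a \<Rightarrow> 'a \<Rightarrow> real"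
    and J :: "'j set" and B :: "'j \<Rightarrow> 'a set" and Q :: "'a set set"
  assumes "pseudometric_on X d" and "X \<noteq> {}"
    and "Q = X // zero_rel X d"
    and "Q = B ` J" and "inj_on B J"
  shows "in_IP X d \<longleftrightarrow>
    dist_partition X d \<in> {tensor1 Q, tensor2 Q} \<union> (if card Q = 4 then {tensor3 Q} else {}) \<and>
    (\<forall>j1\<in>J. \<forall>j2\<in>J. j1 \<noteq> j2 \<longrightarrow> \<not> B j1 \<approx> B j2)"
proof -
  note d = assms(1)
  \<comment> \<open>Injectivity of \<open>B\<close> turns the indexed condition into one on the
    blocks themselves.\<close>
  have blocks: "(\<forall>j1\<in>J. \<forall>j2\<in>J. j1 \<noteq> j2 \<longrightarrow> \<not> B j1 \<approx> B j2) \<longleftrightarrow>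
      (\<forall>A\<in>X // zero_rel X d. \<forall>C\<in>X // zero_rel X d. A \<approx> C \<longrightarrow> A = C)"
    unfolding assms(3)[symmetric] assms(4) using assms(5) by (auto simp: inj_on_def)
  show ?thesis
    \<comment> \<open>The partition condition is rewritten as the symmetry condition of
      \<open>in_IP\<close>. It remains to exchange \<open>Cs X d = PI X d\<close> for the condition
      on cardinalities in its presence.\<close>
    unfolding in_IP_def Cs_refl_dist_eq_Sym_iff[OF d assms(2,3), symmetric] blocks
    unfolding assms(3)
  proof (intro iffI conjI ballI impI d; (elim conjE)?)
    fix A C
    assume "Cs X d = PI X d" "Cs (X // zero_rel X d) (refl_dist d) = Sym (X // zero_rel X d)"
      and "A \<in> X // zero_rel X d" "C \<in> X // zero_rel X d" "A \<approx> C"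
    then show "A = C" using eqpoll_blocks_imp_eq[OF d] by blast
  next
    assume "\<forall>A\<in>X // zero_rel X d. \<forall>C\<in>X // zero_rel X d. A \<approx> C \<longrightarrow> A = C"
    then have "Cs X d \<subseteq> PI X d" by (intro Cs_subset_PI[OF d]) blast
    then show "Cs X d = PI X d" using PI_subset_Cs[OF d] by blast
  qed
qed

end
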